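(* Let $(\mu_k)_{k\ge 0}\subset(0,1)$ be a Carleson sequence (so that the $\mu_k$ are distinct and $\mu_k\to 1$), and let $\nu=\sum_{k\ge 0}(1-\mu_k^2)\,\delta_{\mu_k}$, a discrete measure on $[0,1)$. For $n\ge 2$ let either $\lambda_n=\lceil n\log n\rceil$ for all $n\ge 2$, or $\lambda_n=p_n$ (the $n$th prime number) for all $n\ge 2$. Then, in each of these two cases: (a) $\sum_{n=2}^\infty \frac{1}{\lambda_n}=\infty$; (b) $\lim_{x\to 0+} x\sum_{n=2}^\infty e^{-\lambda_n x}=0$; (c) $\inf_{k\ge 0}\,(1-\mu_k^2)\sum_{n=2}^\infty \mu_k^{2\lambda_n}=0$; (d) there is no constant $A>0$ such that $A\|f\|_{L^2(\nu)}^2\le\sum_{n=2}^\infty|\langle f,t^{\lambda_n}\rangle_{L^2(\nu)}|^2$ for all $f\in L^2(\nu)$; in particular $(t^{\lambda_n})_{n\ge 2}$ is not a frame for $L^2(\nu)$.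
   Context: A sequence $(z_k)_{k\ge 0}$ in the open unit disc $\mathbb{D}$ is a Carleson sequence (equivalently, an interpolating sequence) if there is $\delta>0$ with $\prod_{j\ne k}\left|\frac{z_k-z_j}{1-\overline{z_j}z_k}\right|\ge\delta$ for all $k$. $\delta_x$ denotes the Dirac measure at $x$; $t^\lambda$ denotes the function $t\mapsto t^\lambda$ in $L^2(\nu)$. A family $(x_n)$ in a Hilbert space $H$ is a frame for $H$ if there are constants $A,B>0$ with $A\|x\|^2\le\sum_n|\langle x,x_n\rangle|^2\le B\|x\|^2$ for all $x\in H$. Here $\log$ is the natural logarithm and $p_1=2,p_2=3,\dots$ is the increasing enumeration of the primes. *)

theory Defs
  imports "HOL-Probability.Probability" "HOL-Computational_Algebra.Primes"
    "HOL-Library.Infinite_Set"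
begin

definition pseudo_hyp_dist :: "complex \<Rightarrow> complex \<Rightarrow> real" where
  "pseudo_hyp_dist z w = cmod ((z - w) / (1 - cnj w * z))"

text \<open>All factors lie in \<open>[0, 1]\<close>, so the partial products always converge.  The relation
  \<open>has_prod\<close> excludes precisely the products tending to \<open>0\<close> without a vanishing factor, which
  cannot be bounded below by a positive \<open>\<delta>\<close> anyway.\<close>

definition carleson_seq :: "(nat \<Rightarrow> complex) \<Rightarrow> bool" where
  "carleson_seq z \<longleftrightarrow> (\<forall>k. cmod (z k) < 1) \<and>
     (\<exists>\<delta>>0. \<forall>k. \<exists>p\<ge>\<delta>.
        (\<lambda>j. if j = k then 1 else pseudo_hyp_dist (z k) (z j)) has_prod p)"

abbreviation borel01 :: "real measure" where
  "borel01 \<equiv> restrict_space borel {0..<1}"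

definition nu :: "(nat \<Rightarrow> real) \<Rightarrow> real measure" where
  "nu \<mu> = measure_of (space borel01) (sets borel01)
     (\<lambda>A. \<Sum>k. ennreal (1 - (\<mu> k)\<^sup>2) * emeasure (return borel01 (\<mu> k)) A)"

lemma space_nu [simp]: "space (nu \<mu>) = {0..<1}"
  by (simp add: nu_def space_measure_of_conv space_restrict_space)

lemma sets_nu [simp, measurable_cong]: "sets (nu \<mu>) = sets borel01"
  unfolding nu_def by (rule sets.sets_measure_of_eq)

lemma suminf_swap_ennreal:
  fixes f :: "nat \<Rightarrow> nat \<Rightarrow> ennreal"
  shows "(\<Sum>i. \<Sum>k. f i k) = (\<Sum>k. \<Sum>i. f i k)"
  using nn_integral_suminf[of "\<lambda>i k. f i k" "count_space UNIV"]
  by (simp add: nn_integral_count_space_nat)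

lemma emeasure_nu:
  assumes "A \<in> sets borel01"
  shows "emeasure (nu \<mu>) A = (\<Sum>k. ennreal (1 - (\<mu> k)\<^sup>2) * indicator A (\<mu> k))"
proof -
  let ?m = "\<lambda>A. \<Sum>k. ennreal (1 - (\<mu> k)\<^sup>2) * emeasure (return borel01 (\<mu> k)) A"
  have "countably_additive (sets borel01) ?m"
  proof (rule countably_additiveI)
    fix F :: "nat \<Rightarrow> real set"
    assume F: "range F \<subseteq> sets borel01" "disjoint_family F"
    have "(\<Sum>i. ?m (F i)) =
        (\<Sum>k. \<Sum>i. ennreal (1 - (\<mu> k)\<^sup>2) * emeasure (return borel01 (\<mu> k)) (F i))"
      by (rule suminf_swap_ennreal)
    also have "\<dots> = ?m (\<Union>i. F i)"
      using F by (simp add: suminf_indicator)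
    finally show "(\<Sum>i. ?m (F i)) = ?m (\<Union>i. F i)" .
  qed
  then have "emeasure (nu \<mu>) A = ?m A"
    using assms
    by (intro emeasure_measure_of[OF nu_def sets.space_closed]) (simp_all add: positive_def)
  with assms show ?thesis
    by simp
qed

text \<open>Elements of \<open>L\<^sup>2(M)\<close> are represented by functions; every notion below is invariant under
  equality almost everywhere.\<close>

definition L2 :: "'a measure \<Rightarrow> ('a \<Rightarrow> complex) set" where
  "L2 M = {f. f \<in> borel_measurable M \<and> integrable M (\<lambda>t. (cmod (f t))\<^sup>2)}"

definition L2_inner :: "'a measure \<Rightarrow> ('a \<Rightarrow> complex) \<Rightarrow> ('a \<Rightarrow> complex) \<Rightarrow> complex" where
  "L2_inner M f g = (LINT t|M. f t * cnj (g t))"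

definition L2_norm :: "'a measure \<Rightarrow> ('a \<Rightarrow> complex) \<Rightarrow> real" where
  "L2_norm M f = sqrt (LINT t|M. (cmod (f t))\<^sup>2)"

text \<open>The sums are taken in \<open>[0, \<infinity>]\<close>, so that they make sense for families without an upper
  frame bound.\<close>

definition L2_lower_bound :: "'a measure \<Rightarrow> 'i set \<Rightarrow> ('i \<Rightarrow> 'a \<Rightarrow> complex) \<Rightarrow> real \<Rightarrow> bool" where
  "L2_lower_bound M I x A \<longleftrightarrow> (\<forall>f\<in>L2 M.
     ennreal (A * (L2_norm M f)\<^sup>2) \<le> (\<Sum>\<^sub>\<infinity>n\<in>I. ennreal ((cmod (L2_inner M f (x n)))\<^sup>2)))"

definition L2_upper_bound :: "'a measure \<Rightarrow> 'i set \<Rightarrow> ('i \<Rightarrow> 'a \<Rightarrow> complex) \<Rightarrow> real \<Rightarrow> bool" where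
  "L2_upper_bound M I x B \<longleftrightarrow> (\<forall>f\<in>L2 M.
     (\<Sum>\<^sub>\<infinity>n\<in>I. ennreal ((cmod (L2_inner M f (x n)))\<^sup>2)) \<le> ennreal (B * (L2_norm M f)\<^sup>2))"

definition L2_frame :: "'a measure \<Rightarrow> 'i set \<Rightarrow> ('i \<Rightarrow> 'a \<Rightarrow> complex) \<Rightarrow> bool" where
  "L2_frame M I x \<longleftrightarrow> (\<forall>n\<in>I. x n \<in> L2 M) \<and>
     (\<exists>A>0. \<exists>B>0. L2_lower_bound M I x A \<and> L2_upper_bound M I x B)"

definition power_fun :: "nat \<Rightarrow> real \<Rightarrow> complex" where
  "power_fun m = (\<lambda>t. complex_of_real (t ^ m))"

text \<open>Primes are numbered from 1: \<open>nth_prime 1 = 2\<close>, \<open>nth_prime 2 = 3\<close>; the value at 0 is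
  meaningless.\<close>

definition nth_prime :: "nat \<Rightarrow> nat" where
  "nth_prime n = enumerate {p. prime p} (n - 1)"

end

theory Submission imports Defs "HOL-Number_Theory.Totient"
begin

text \<open>Both exponent sequences satisfy \<open>\<lambda>\<^sub>n / n \<longlongrightarrow> \<infinity>\<close>, and this alone gives (b): if \<open>\<lambda>\<^sub>n \<ge> M n\<close> for
  \<open>n \<ge> N\<close>, comparison with a geometric series bounds \<open>x \<Sum> e\<^bsup>- \<lambda>\<^sub>n x\<^esup>\<close> by \<open>(N + 1) x + 1 / M\<close>.
  A Carleson sequence in \<open>(0, 1)\<close> tends to 1, so (c) follows from (b) at \<open>x = - 2 log \<mu>\<^sub>k \<ge> 1 - \<mu>\<^sub>k\<^sup>2\<close>,
  and (d) follows from (c) by testing on the indicator functions of the atoms of \<open>\<nu>\<close>.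

  For the primes, sieving the harmonic sum gives \<open>H\<^sub>N \<Prod>\<^sub>p\<^sub>\<le>\<^sub>N (1 - 1 / p) \<le> 1\<close>.  Hence \<open>\<Sum> 1 / p\<close>
  diverges, and the density \<open>\<phi>(P) / P\<close> of the integers coprime to the product \<open>P\<close> of the primes up to
  \<open>N\<close> tends to 0, which forces \<open>p\<^sub>n / n \<longlongrightarrow> \<infinity>\<close>.\<close>

section \<open>Extended nonnegative sums\<close>

lemma infsum_ennreal_le:
  assumes "\<And>x. x \<in> A \<Longrightarrow> 0 \<le> f x"
    and "\<And>F. finite F \<Longrightarrow> F \<subseteq> A \<Longrightarrow> sum f F \<le> B"
  shows "(\<Sum>\<^sub>\<infinity>x\<in>A. ennreal (f x)) \<le> ennreal B"
proof -
  have "(\<Sum>\<^sub>\<infinity>x\<in>A. ennreal (f x)) = (SUP F\<in>{F. finite F \<and> F \<subseteq> A}. \<Sum>x\<in>F. ennreal (f x))"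
    by (rule nonneg_infsum_complete) simp
  also have "\<dots> \<le> ennreal B"
  proof (rule SUP_least)
    fix F assume F: "F \<in> {F. finite F \<and> F \<subseteq> A}"
    then have "(\<Sum>x\<in>F. ennreal (f x)) = ennreal (sum f F)"
      using assms(1) by (intro sum_ennreal) auto
    also have "\<dots> \<le> ennreal B"
      using F assms(2) by (intro ennreal_leI) auto
    finally show "(\<Sum>x\<in>F. ennreal (f x)) \<le> ennreal B" .
  qed
  finally show ?thesis .
qed

text \<open>Reduces divergence to unbounded finite partial sums; both cases of (a) are proved
  through it.\<close>

lemma infsum_ennreal_eq_infinity:
  assumes "\<And>x. x \<in> A \<Longrightarrow> 0 \<le> f x"
    and "\<And>C. \<exists>F. finite F \<and> F \<subseteq> A \<and> C \<le> sum f F"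
  shows "(\<Sum>\<^sub>\<infinity>x\<in>A. ennreal (f x)) = \<infinity>"
proof (rule ccontr)
  let ?s = "\<Sum>\<^sub>\<infinity>x\<in>A. ennreal (f x)"
  assume "?s \<noteq> \<infinity>"
  then obtain c where c: "0 \<le> c" "?s = ennreal c"
    by (cases ?s) auto
  obtain F where F: "finite F" "F \<subseteq> A" "c + 1 \<le> sum f F"
    using assms(2) by blast
  have "ennreal (c + 1) \<le> ennreal (sum f F)"
    using F by (intro ennreal_leI)
  also have "\<dots> = (\<Sum>x\<in>F. ennreal (f x))"
    using F assms(1) by (intro sum_ennreal[symmetric]) auto
  also have "\<dots> \<le> ?s"
    unfolding nonneg_infsum_complete[of A "\<lambda>x. ennreal (f x)", simplified]
    using F by (intro SUP_upper) auto
  finally show False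
    using c by simp
qed

lemma infsum_cmult_ennreal:
  fixes f :: "'a \<Rightarrow> ennreal"
  shows "(\<Sum>\<^sub>\<infinity>x\<in>A. c * f x) = c * (\<Sum>\<^sub>\<infinity>x\<in>A. f x)"
proof -
  have "(\<Sum>\<^sub>\<infinity>x\<in>A. c * f x) = (SUP F\<in>{F. finite F \<and> F \<subseteq> A}. \<Sum>x\<in>F. c * f x)"
    by (rule nonneg_infsum_complete) simp
  also have "\<dots> = c * (SUP F\<in>{F. finite F \<and> F \<subseteq> A}. sum f F)"
    by (simp add: SUP_mult_left_ennreal sum_distrib_left)
  also have "(SUP F\<in>{F. finite F \<and> F \<subseteq> A}. sum f F) = (\<Sum>\<^sub>\<infinity>x\<in>A. f x)"
    by (rule nonneg_infsum_complete[symmetric]) simp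
  finally show ?thesis .
qed

section \<open>Primes\<close>

text \<open>Sieving by one more \<open>p\<close> removes the multiples of \<open>p\<close>; dividing these by \<open>p\<close> lands in the
  old sieved set, so they carry at most the fraction \<open>1 / p\<close> of its harmonic mass.\<close>

lemma harm_mult_prod_le_sieved_sum:
  assumes "finite S" "0 \<notin> S"
  shows "harm N * (\<Prod>p\<in>S. 1 - 1 / real p)
    \<le> (\<Sum>n | n \<in> {1..N} \<and> (\<forall>p\<in>S. \<not> p dvd n). 1 / real n)"
  using assms
proof (induction S rule: finite_induct)
  case empty
  have "{1..N} = {n. n \<in> {1..N} \<and> (\<forall>p\<in>{}. \<not> p dvd n)}"
    by auto
  then show ?case
    by (simp add: harm_def divide_inverse)
next
  case (insert p S)
  define A where "A = {n. n \<in> {1..N} \<and> (\<forall>q\<in>S. \<not> q dvd n)}"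
  define D where "D = {n \<in> A. p dvd n}"
  have fin: "finite A" "finite D"
    by (simp_all add: A_def D_def)
  have p: "p > 0"
    using insert.prems by auto
  have inj: "inj_on (\<lambda>n. n div p) D"
    using p by (auto simp: inj_on_def D_def)
  have img: "(\<lambda>n. n div p) ` D \<subseteq> A"
  proof
    fix m assume "m \<in> (\<lambda>n. n div p) ` D"
    then obtain n where n: "n \<in> A" "n = p * m"
      using p by (auto simp: D_def)
    have "m \<le> n"
      using n p by simp
    moreover have "m \<noteq> 0"
      using n by (auto simp: A_def)
    \<comment> \<open>A divisor \<open>q\<close> of \<open>m\<close> would divide
      \<open>n = p * m\<close>, which has survived the sieve by \<open>S\<close>.\<close>
    moreover have "n \<le> N" "\<forall>q\<in>S. \<not> q dvd m"
      using n by (auto simp: A_def)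
    ultimately show "m \<in> A"
      by (simp add: A_def)
  qed
  have "(\<Sum>n\<in>D. 1 / real n) = (\<Sum>n\<in>D. 1 / real p * (1 / real (n div p)))"
    by (intro sum.cong) (auto simp: D_def real_of_nat_div)
  also have "\<dots> = 1 / real p * (\<Sum>m\<in>(\<lambda>n. n div p) ` D. 1 / real m)"
    by (simp only: sum_distrib_left sum.reindex[OF inj] o_def)
  also have "\<dots> \<le> 1 / real p * (\<Sum>m\<in>A. 1 / real m)"
    using fin img by (intro mult_left_mono sum_mono2) auto
  finally have "(1 - 1 / real p) * (\<Sum>n\<in>A. 1 / real n) \<le> (\<Sum>n\<in>A. 1 / real n) - (\<Sum>n\<in>D. 1 / real n)"
    by (simp add: algebra_simps)
  also have "\<dots> = (\<Sum>n\<in>A - D. 1 / real n)"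
    using fin by (intro sum_diff[symmetric]) (auto simp: D_def)
  also have "A - D = {n. n \<in> {1..N} \<and> (\<forall>q\<in>insert p S. \<not> q dvd n)}"
    by (auto simp: A_def D_def)
  finally have step: "(1 - 1 / real p) * (\<Sum>n\<in>A. 1 / real n)
      \<le> (\<Sum>n | n \<in> {1..N} \<and> (\<forall>q\<in>insert p S. \<not> q dvd n). 1 / real n)" .
  have "harm N * (\<Prod>q\<in>insert p S. 1 - 1 / real q)
      = (1 - 1 / real p) * (harm N * (\<Prod>q\<in>S. 1 - 1 / real q))"
    using insert.hyps by simp
  also have "\<dots> \<le> (1 - 1 / real p) * (\<Sum>n\<in>A. 1 / real n)"
    using insert p unfolding A_def by (intro mult_left_mono) auto
  finally show ?case
    using step by linarith
qed

text \<open>Every integer in \<open>{2..N}\<close> has a prime factor at most \<open>N\<close>, so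
  only 1 survives the sieve.\<close>

lemma harm_mult_prod_primes_le_1:
  "harm N * (\<Prod>p | prime p \<and> p \<le> N. 1 - 1 / real p) \<le> 1"
proof -
  have "{n. n \<in> {1..N} \<and> (\<forall>p\<in>{p. prime p \<and> p \<le> N}. \<not> p dvd n)} \<subseteq> {1}"
  proof
    fix n assume n: "n \<in> {n. n \<in> {1..N} \<and> (\<forall>p\<in>{p. prime p \<and> p \<le> N}. \<not> p dvd n)}"
    show "n \<in> {1}"
    proof (rule ccontr)
      assume "n \<notin> {1}"
      then obtain p where "prime p" "p dvd n"
        using prime_factor_nat by auto
      moreover from this n have "p \<le> N"
        using dvd_imp_le[of p n] by auto
      ultimately show False
        using n by auto
    qed
  qed
  then have "(\<Sum>n | n \<in> {1..N} \<and> (\<forall>p\<in>{p. prime p \<and> p \<le> N}. \<not> p dvd n). 1 / real n)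
      \<le> (\<Sum>n\<in>{1}. 1 / real n)"
    by (intro sum_mono2) auto
  with harm_mult_prod_le_sieved_sum[of "{p. prime p \<and> p \<le> N}" N] show ?thesis
    by simp
qed

text \<open>Converts the product over primes into an exponential of the sum of \<open>1 / p\<close>;
  the range of \<open>x\<close> fits because primes are at least 2.\<close>

lemma exp_neg_double_le:
  fixes x :: real
  assumes "0 \<le> x" "x \<le> 1 / 2"
  shows "exp (- 2 * x) \<le> 1 - x"
proof -
  have "1 \<le> (1 - x) * (1 + 2 * x)"
    using mult_nonneg_nonneg[of x "1 - 2 * x"] assms by (simp add: algebra_simps)
  also have "\<dots> \<le> (1 - x) * exp (2 * x)"
    using assms exp_ge_add_one_self[of "2 * x"] by (intro mult_left_mono) auto
  finally show ?thesis
    by (simp add: exp_minus field_simps)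
qed

text \<open>The product is at least \<open>exp (- 2 * s)\<close>, where \<open>s\<close> is the sum
  of the \<open>1 / p\<close>, so the sieve bound gives \<open>harm N \<le> exp (2 * s)\<close>.
  Once \<open>harm N\<close> reaches \<open>exp (2 * C)\<close>, this forces
  \<open>C \<le> s\<close>.\<close>

lemma sum_inverse_primes_unbounded:
  "\<exists>N. C \<le> (\<Sum>p | prime p \<and> p \<le> N. 1 / real p)"
proof -
  obtain N where N: "exp (2 * C) \<le> harm N"
    using harm_at_top unfolding filterlim_at_top eventually_sequentially by blast
  let ?S = "{p. prime p \<and> p \<le> N}"
  have "exp (2 * C) * exp (- 2 * (\<Sum>p\<in>?S. 1 / real p))
      = exp (2 * C) * (\<Prod>p\<in>?S. exp (- 2 * (1 / real p)))"
    by (simp add: sum_distrib_left exp_sum)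
  also have "\<dots> \<le> harm N * (\<Prod>p\<in>?S. 1 - 1 / real p)"
  proof (intro mult_mono prod_mono conjI N exp_neg_double_le prod_nonneg)
    fix p assume "p \<in> ?S"
    then have "2 \<le> p"
      using prime_ge_2_nat by auto
    then show "1 / real p \<le> 1 / 2"
      by (simp add: field_simps)
  qed (auto simp: harm_nonneg)
  also have "\<dots> \<le> 1"
    by (rule harm_mult_prod_primes_le_1)
  finally have "2 * C - 2 * (\<Sum>p\<in>?S. 1 / real p) \<le> 0"
    by (simp flip: exp_add)
  then show ?thesis
    by (intro exI[of _ N]) simp
qed

section \<open>Density of the integers coprime to a modulus, and growth of the primes\<close>

text \<open>Coprimality to \<open>P\<close> is invariant under shifts by \<open>P\<close>, so each
  block of length \<open>P\<close> adds at most \<open>totient P\<close> elements.\<close>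

lemma card_coprime_le:
  "card {m. 0 < m \<and> m \<le> K * P \<and> coprime m P} \<le> K * totient P"
proof (induction K)
  case (Suc K)
  let ?A = "\<lambda>K. {m. 0 < m \<and> m \<le> K * P \<and> coprime m P}"
  have sub: "?A (Suc K) \<subseteq> ?A K \<union> (\<lambda>m. m + K * P) ` totatives P"
  proof
    fix m assume m: "m \<in> ?A (Suc K)"
    show "m \<in> ?A K \<union> (\<lambda>m. m + K * P) ` totatives P"
    proof (cases "m \<le> K * P")
      case False
      then have "gcd P (m - K * P) = gcd P m"
        using gcd_add_mult[of P K "m - K * P"] by simp
      with False have "m - K * P \<in> totatives P"
        using m by (simp add: in_totatives_iff le_diff_conv coprime_iff_gcd_eq_1 gcd.commute[of _ P])
      then show ?thesis
        using False by (intro UnI2 image_eqI[of _ _ "m - K * P"]) auto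
    qed (use m in auto)
  qed
  have "card (?A (Suc K)) \<le> card (?A K \<union> (\<lambda>m. m + K * P) ` totatives P)"
    using sub by (intro card_mono) auto
  also have "\<dots> \<le> card (?A K) + card ((\<lambda>m. m + K * P) ` totatives P)"
    by (rule card_Un_le)
  also have "\<dots> \<le> K * totient P + totient P"
    using Suc.IH unfolding totient_def by (intro add_mono card_image_le) auto
  finally show ?case
    by simp
qed auto

lemma infinite_primes_nat: "infinite {p :: nat. prime p}"
  using primes_infinite by blast

text \<open>Up to \<open>p = nth_prime n\<close> there are \<open>n\<close> primes, each at most
  \<open>N\<close> or coprime to \<open>P\<close>, so \<open>n \<le> C + p * r\<close> with
  \<open>r = totient P / P\<close>. The choice \<open>harm N \<ge> 2 * M\<close> gives
  \<open>2 * M * r \<le> 1\<close>; the factor 2 is spent on absorbing \<open>C\<close> once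
  \<open>n \<ge> 2 * C\<close>.\<close>

lemma nth_prime_superlinear:
  "filterlim (\<lambda>n. real (nth_prime n) / real n) at_top sequentially"
  unfolding filterlim_at_top_gt[where c = 0]
proof (intro allI impI)
  fix M :: real assume M: "0 < M"
  obtain N where N: "2 * M \<le> harm N"
    using harm_at_top unfolding filterlim_at_top eventually_sequentially by blast
  define S where "S = {p. prime p \<and> p \<le> N}"
  define P where "P = \<Prod>S"
  have S: "finite S" "\<And>p. p \<in> S \<Longrightarrow> prime p"
    by (auto simp: S_def)
  have P: "P > 0"
    using S by (auto simp: P_def prime_gt_0_nat intro!: prod_pos)
  \<comment> \<open>Identifies the Euler product for \<open>totient P\<close> with the sieve product
    over \<open>S\<close>.\<close>
  have pf: "prime_factors P = S"
  proof (intro equalityI subsetI)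
    fix p assume "p \<in> prime_factors P"
    then have p: "prime p" "p dvd \<Prod>S"
      by (auto simp: P_def)
    then obtain q where "q \<in> S" "p dvd q"
      using prime_dvd_prod_iff[of S p "\<lambda>x. x"] S by auto
    then show "p \<in> S"
      using p S primes_dvd_imp_eq by blast
  next
    fix p assume p: "p \<in> S"
    then have "p dvd P"
      unfolding P_def using S by (intro dvd_prodI)
    then show "p \<in> prime_factors P"
      using p P S by (simp add: prime_factors_dvd)
  qed
  define r where "r = (\<Prod>p\<in>S. 1 - 1 / real p)"
  have r0: "r \<ge> 0"
    using S prime_gt_0_nat unfolding r_def by (intro prod_nonneg) (auto simp: Suc_le_eq)
  have "2 * M * r \<le> harm N * r"
    using N r0 by (rule mult_right_mono)
  then have r: "2 * M * r \<le> 1"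
    using harm_mult_prod_primes_le_1[of N] by (simp add: r_def S_def)
  have tot: "real (totient P) = real P * r"
    by (simp add: totient_formula2 pf r_def)
  \<comment> \<open>\<open>N + 1\<close> counts \<open>{..N}\<close>, with 0 included; the extra
    \<open>totient P\<close> pays for the incomplete last block in
    \<open>K = p div P + 1\<close>.\<close>
  define C where "C = real (N + 1 + totient P)"
  have key: "M * real n \<le> real (nth_prime n)" if n: "n \<ge> 1" "2 * C \<le> real n" for n
  proof -
    define p where "p = nth_prime n"
    define K where "K = p div P + 1"
    let ?e = "enumerate {p :: nat. prime p}" and ?A = "{m. 0 < m \<and> m \<le> K * P \<and> coprime m P}"
    \<comment> \<open>The enumeration starts at index 0, so the indices below \<open>n\<close> give
      the first \<open>n\<close> primes, the last of which is \<open>p\<close>. A prime above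
      \<open>N\<close> is coprime to every prime in \<open>S\<close>.\<close>
    have "?e ` {..<n} \<subseteq> {..N} \<union> ?A"
    proof
      fix q assume "q \<in> ?e ` {..<n}"
      then have q: "prime q" "q \<le> p"
        using enumerate_in_set[OF infinite_primes_nat] n
        by (auto simp: p_def nth_prime_def infinite_primes_nat)
      have "q \<le> K * P"
        using q(2) div_mult_mod_eq[of p P] mod_less_divisor[OF P, of p]
        unfolding K_def add_mult_distrib by linarith
      moreover have "coprime q P" if "q > N"
        unfolding P_def
      proof (rule prod_coprime_right)
        fix s assume "s \<in> S"
        then show "coprime q s"
          using that q(1) by (intro primes_coprime) (auto simp: S_def)
      qed
      ultimately show "q \<in> {..N} \<union> ?A"
        using q(1) prime_gt_0_nat by (cases "q > N") auto
    qed
    then have "card (?e ` {..<n}) \<le> card ({..N} \<union> ?A)"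
      by (intro card_mono) auto
    also have "\<dots> \<le> card {..N} + card ?A"
      by (rule card_Un_le)
    also have "\<dots> \<le> (N + 1) + K * totient P"
      using card_coprime_le[of K P] by simp
    also have "card (?e ` {..<n}) = n"
      using inj_enumerate[OF infinite_primes_nat] by (simp add: card_image inj_on_subset)
    finally have "real n \<le> real ((N + 1) + K * totient P)"
      by (simp only: of_nat_le_iff)
    also have "\<dots> = C + real (p div P) * real (totient P)"
      by (simp add: K_def C_def algebra_simps)
    also have "\<dots> \<le> C + real p / real P * real (totient P)"
      using of_nat_div_le_of_nat[of p P, where 'a = real] by (intro add_left_mono mult_right_mono) auto
    also have "\<dots> = C + real p * r"
      using P by (simp add: tot)
    finally have "real n - C \<le> real p * r"
      by simp
    then have "2 * M * (real n - C) \<le> 2 * M * (real p * r)"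
      using M by (intro mult_left_mono) auto
    also have "\<dots> = real p * (2 * M * r)"
      by simp
    also have "\<dots> \<le> real p"
      using mult_left_mono[OF r, of "real p"] by simp
    finally have "2 * M * (real n - C) \<le> real p" .
    moreover have "M * real n \<le> 2 * M * (real n - C)"
      using mult_left_mono[OF n(2), of M] M by (simp add: algebra_simps)
    ultimately show ?thesis
      by (simp add: p_def)
  qed
  show "eventually (\<lambda>n. M \<le> real (nth_prime n) / real n) sequentially"
    unfolding eventually_sequentially
  proof (intro exI allI impI)
    fix n assume n: "n \<ge> nat \<lceil>2 * C\<rceil> + 1"
    then have "2 * C \<le> real n" "n \<ge> 1"
      by linarith+
    with key[of n] show "M \<le> real (nth_prime n) / real n"
      by (simp add: field_simps)
  qed
qed

text \<open>Starting at index 2 omits only the prime \<open>nth_prime 1\<close>; raising the target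
  \<open>C\<close> by its reciprocal compensates for the loss.\<close>

lemma infsum_inverse_nth_prime:
  "(\<Sum>\<^sub>\<infinity>n\<in>{2..}. ennreal (1 / real (nth_prime n))) = \<infinity>"
proof -
  have inj: "inj_on nth_prime {2..}"
    by (auto simp: inj_on_def nth_prime_def inj_eq[OF inj_enumerate[OF infinite_primes_nat]])
  have img: "{p. prime p} - {nth_prime 1} \<subseteq> nth_prime ` {2..}"
  proof
    fix p assume p: "p \<in> {p. prime p} - {nth_prime 1}"
    then obtain m where m: "enumerate {p. prime p} m = p"
      using enumerate_Ex[OF infinite_primes_nat] by auto
    then have "m \<noteq> 0"
      using p by (cases "m = 0") (auto simp: nth_prime_def)
    with m show "p \<in> nth_prime ` {2..}"
      by (intro image_eqI[of _ _ "Suc m"]) (auto simp: nth_prime_def)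
  qed
  have "(\<Sum>\<^sub>\<infinity>n\<in>{2..}. ennreal (1 / real (nth_prime n)))
      = (\<Sum>\<^sub>\<infinity>p\<in>nth_prime ` {2..}. ennreal (1 / real p))"
    using infsum_reindex[OF inj, of "\<lambda>p. ennreal (1 / real p)"] by (simp add: o_def)
  also have "\<dots> = \<infinity>"
  proof (rule infsum_ennreal_eq_infinity)
    fix C :: real
    obtain N where N: "C + 1 / real (nth_prime 1) \<le> (\<Sum>p | prime p \<and> p \<le> N. 1 / real p)"
      using sum_inverse_primes_unbounded by blast
    let ?S = "{p. prime p \<and> p \<le> N}"
    have fin: "finite ?S" by simp
    have "(\<Sum>p\<in>?S. 1 / real p) \<le> (\<Sum>p\<in>?S - {nth_prime 1}. 1 / real p) + 1 / real (nth_prime 1)"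
      by (simp add: sum_diff1[OF fin])
    with N have "C \<le> (\<Sum>p\<in>?S - {nth_prime 1}. 1 / real p)"
      by linarith
    then show "\<exists>F. finite F \<and> F \<subseteq> nth_prime ` {2..} \<and> C \<le> (\<Sum>p\<in>F. 1 / real p)"
      using img by (intro exI[of _ "?S - {nth_prime 1}"]) auto
  qed simp
  finally show ?thesis .
qed

section \<open>The exponents \<open>\<lceil>n log n\<rceil>\<close>\<close>

lemma ceiling_n_ln_n_superlinear:
  "filterlim (\<lambda>n. real (nat \<lceil>real n * ln (real n)\<rceil>) / real n) at_top sequentially"
proof (rule filterlim_at_top_mono)
  show "filterlim (\<lambda>n. ln (real n)) at_top sequentially"
    by (rule filterlim_compose[OF ln_at_top filterlim_real_sequentially])
  show "eventually (\<lambda>n. ln (real n) \<le> real (nat \<lceil>real n * ln (real n)\<rceil>) / real n) sequentially"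
    using eventually_gt_at_top[of 0]
  proof eventually_elim
    case (elim n)
    have "real n * ln (real n) \<le> real (nat \<lceil>real n * ln (real n)\<rceil>)"
      by (rule real_nat_ceiling_ge)
    then show ?case
      using elim by (simp add: field_simps)
  qed
qed

text \<open>A discrete form of the integral test, as \<open>ln (ln x)\<close> is a primitive of
  \<open>1 / (x * ln x)\<close>. It follows from \<open>ln y \<le> y - 1\<close> and
  \<open>ln (1 + y) \<le> y\<close>.\<close>

lemma ln_ln_Suc_diff_le:
  assumes "n \<ge> 2"
  shows "ln (ln (real (Suc n))) - ln (ln (real n)) \<le> 1 / (real n * ln (real n))"
proof -
  have l: "0 < ln (real n)" "0 < ln (real (Suc n))"
    using assms by simp_all
  have "ln (ln (real (Suc n))) - ln (ln (real n)) = ln (ln (real (Suc n)) / ln (real n))"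
    using l by (simp add: ln_div)
  also have "\<dots> \<le> ln (real (Suc n)) / ln (real n) - 1"
    using l by (intro ln_le_minus_one) simp
  also have "\<dots> = (ln (real (Suc n)) - ln (real n)) / ln (real n)"
    using l by (simp add: field_simps)
  also have "ln (real (Suc n)) - ln (real n) = ln (1 + 1 / real n)"
    using assms ln_div[of "real (Suc n)" "real n"] by (simp add: field_simps)
  also have "ln (1 + 1 / real n) / ln (real n) \<le> (1 / real n) / ln (real n)"
    using l by (intro divide_right_mono ln_add_one_self_le_self) auto
  finally show ?thesis
    by simp
qed

text \<open>Rounding up adds less than 1, and \<open>n * ln n\<close> is already at least
  \<open>2 * ln 2 \<ge> 1\<close>.\<close>

lemma ceiling_n_ln_n_le:
  assumes "n \<ge> 2"
  shows "real (nat \<lceil>real n * ln (real n)\<rceil>) \<le> 2 * (real n * ln (real n))"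
proof -
  have "1 \<le> 2 * ln (2::real)"
    using ln2_ge_two_thirds by linarith
  also have "\<dots> \<le> real n * ln (real n)"
    using assms by (intro mult_mono) auto
  finally show ?thesis
    by linarith
qed

text \<open>Telescoping the unbounded \<open>ln (ln n)\<close> bounds the partial sums from below.
  The target is doubled because rounding up may cost a factor 2.\<close>

lemma infsum_inverse_ceiling_n_ln_n:
  "(\<Sum>\<^sub>\<infinity>n\<in>{2..}. ennreal (1 / real (nat \<lceil>real n * ln (real n)\<rceil>))) = \<infinity>"
proof (rule infsum_ennreal_eq_infinity)
  fix C :: real
  have "filterlim (\<lambda>n. ln (ln (real n))) at_top sequentially"
    by (intro filterlim_compose[OF ln_at_top] filterlim_real_sequentially)
  then obtain N where N: "\<And>n. n \<ge> N \<Longrightarrow> ln (ln 2) + 2 * C \<le> ln (ln (real n))"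
    unfolding filterlim_at_top eventually_sequentially by blast
  define L where "L = max N 2"
  have "2 * C \<le> ln (ln (real L)) - ln (ln (real 2))"
    using N[of L] by (simp add: L_def)
  also have "\<dots> = (\<Sum>n = 2..<L. ln (ln (real (Suc n))) - ln (ln (real n)))"
    by (rule sum_Suc_diff'[symmetric]) (simp add: L_def)
  also have "\<dots> \<le> (\<Sum>n = 2..<L. 2 * (1 / real (nat \<lceil>real n * ln (real n)\<rceil>)))"
  proof (rule sum_mono)
    fix n assume "n \<in> {2..<L}"
    then have n: "n \<ge> 2" by simp
    then have pos: "0 < real n * ln (real n)"
      by simp
    then have "0 < real (nat \<lceil>real n * ln (real n)\<rceil>)"
      by simp
    then have "1 / (real n * ln (real n)) \<le> 2 * (1 / real (nat \<lceil>real n * ln (real n)\<rceil>))"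
      using ceiling_n_ln_n_le[OF n] pos by (simp add: divide_simps)
    then show "ln (ln (real (Suc n))) - ln (ln (real n)) \<le> 2 * (1 / real (nat \<lceil>real n * ln (real n)\<rceil>))"
      by (rule order_trans[OF ln_ln_Suc_diff_le[OF n]])
  qed
  finally have "C \<le> (\<Sum>n = 2..<L. 1 / real (nat \<lceil>real n * ln (real n)\<rceil>))"
    unfolding sum_distrib_left[symmetric] by linarith
  then show "\<exists>F. finite F \<and> F \<subseteq> {2..} \<and> C \<le> (\<Sum>n\<in>F. 1 / real (nat \<lceil>real n * ln (real n)\<rceil>))"
    by (intro exI[of _ "{2..<L}"] conjI) auto
qed (simp only: zero_le_divide_1_iff of_nat_0_le_iff)

section \<open>Superlinear exponents\<close>

text \<open>The first \<open>N\<close> terms are at most 1 each, the others at most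
  \<open>r ^ n\<close>; then \<open>1 / (1 - r) \<le> 1 + 1 / (M * x)\<close> amounts to
  \<open>1 + M * x \<le> exp (M * x)\<close>. The bound is uniform in \<open>F\<close>, so it passes
  to the infinite sum.\<close>

lemma sum_exp_le:
  fixes M x :: real
  assumes "M > 0" "x > 0" "finite F"
    and N: "\<And>n. n \<ge> N \<Longrightarrow> M * real n \<le> real (lam n)"
  shows "(\<Sum>n\<in>F. exp (- real (lam n) * x)) \<le> real N + 1 + 1 / (M * x)"
proof -
  define r where "r = exp (- (M * x))"
  have r: "0 < r" "r < 1"
    using assms by (simp_all add: r_def)
  have "(\<Sum>n\<in>F. exp (- real (lam n) * x)) \<le> (\<Sum>n\<in>{..<N} \<union> F. exp (- real (lam n) * x))"
    using assms by (intro sum_mono2) auto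
  also have "{..<N} \<union> F = {..<N} \<union> (F - {..<N})"
    by auto
  also have "(\<Sum>n\<in>\<dots>. exp (- real (lam n) * x))
      = (\<Sum>n<N. exp (- real (lam n) * x)) + (\<Sum>n\<in>F - {..<N}. exp (- real (lam n) * x))"
    using assms by (intro sum.union_disjoint) auto
  also have "\<dots> \<le> (\<Sum>n<N. 1) + (\<Sum>n\<in>F - {..<N}. r ^ n)"
  proof (intro add_mono sum_mono)
    fix n assume "n \<in> F - {..<N}"
    then have "M * real n * x \<le> real (lam n) * x"
      using N[of n] assms by (intro mult_right_mono) auto
    then show "exp (- real (lam n) * x) \<le> r ^ n"
      unfolding r_def exp_of_nat_mult[symmetric] by (simp add: algebra_simps)
  qed (use assms in auto)
  also have "(\<Sum>n\<in>F - {..<N}. r ^ n) \<le> (\<Sum>n. r ^ n)"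
    using assms r by (intro sum_le_suminf) (auto intro: summable_geometric)
  also have "(\<Sum>n. r ^ n) = 1 / (1 - r)"
    using r by (intro suminf_geometric) auto
  also have "1 / (1 - r) \<le> 1 + 1 / (M * x)"
  proof -
    have "(1 + M * x) * r \<le> exp (M * x) * r"
      using exp_ge_add_one_self[of "M * x"] r by (intro mult_right_mono) auto
    also have "\<dots> = 1"
      by (simp add: r_def exp_minus)
    finally have "M * x \<le> (1 + M * x) * (1 - r)"
      by (simp add: algebra_simps)
    then show ?thesis
      using assms r by (simp add: field_simps)
  qed
  finally show ?thesis
    by simp
qed

lemma tendsto_mult_infsum_exp:
  assumes "filterlim (\<lambda>n. real (lam n) / real n) at_top sequentially"
  shows "((\<lambda>x::real. ennreal x * (\<Sum>\<^sub>\<infinity>n\<in>A. ennreal (exp (- real (lam n) * x))))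
          \<longlongrightarrow> 0) (at_right 0)"
proof (rule order_tendstoI)
  fix a :: ennreal assume "0 < a"
  \<comment> \<open>\<open>a\<close> may be infinite, so a finite \<open>e\<close> below it serves
    as the margin.\<close>
  then obtain e where e: "0 < e" "ennreal e < a"
    by (metis dense ennreal_cases ennreal_less_zero_iff less_top_ennreal top.not_eq_extremum order.strict_trans ennreal_neq_top)
  \<comment> \<open>After multiplication by \<open>x\<close> the term \<open>1 / (M * x)\<close>
    becomes \<open>e / 2\<close>; the range of \<open>x\<close> chosen below keeps
    \<open>x * (N + 1)\<close> under \<open>e / 2\<close> as well.\<close>
  define M where "M = 2 / e"
  have M: "M > 0"
    using e by (simp add: M_def)
  obtain N0 where N0: "\<And>n. n \<ge> N0 \<Longrightarrow> M \<le> real (lam n) / real n"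
    using assms unfolding filterlim_at_top eventually_sequentially by blast
  define N where "N = max N0 1"
  have N: "M * real n \<le> real (lam n)" if "n \<ge> N" for n
    using N0[of n] that by (simp add: N_def field_simps)
  have "eventually (\<lambda>x::real. x < e / (2 * (real N + 1))) (at_right 0)"
    using e by (intro order_tendstoD(2)[OF tendsto_ident_at]) auto
  moreover have "eventually (\<lambda>x::real. x > 0) (at_right 0)"
    by (simp add: eventually_at_right_less)
  ultimately show "eventually (\<lambda>x::real. ennreal x *
      (\<Sum>\<^sub>\<infinity>n\<in>A. ennreal (exp (- real (lam n) * x))) < a) (at_right 0)"
  proof eventually_elim
    case (elim x)
    have "(\<Sum>\<^sub>\<infinity>n\<in>A. ennreal (exp (- real (lam n) * x))) \<le> ennreal (real N + 1 + 1 / (M * x))"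
      using elim M N by (intro infsum_ennreal_le sum_exp_le) auto
    then have "ennreal x * (\<Sum>\<^sub>\<infinity>n\<in>A. ennreal (exp (- real (lam n) * x)))
        \<le> ennreal x * ennreal (real N + 1 + 1 / (M * x))"
      by (intro mult_left_mono) auto
    also have "\<dots> = ennreal (x * (real N + 1) + e / 2)"
      using elim M by (simp add: ennreal_mult'[symmetric] M_def algebra_simps)
    also have "\<dots> \<le> ennreal e"
      using elim by (intro ennreal_leI) (simp add: field_simps)
    finally show ?case
      using e(2) by (rule le_less_trans)
  qed
qed simp

section \<open>Carleson sequences\<close>

text \<open>Real case of the classical identity for the pseudohyperbolic distance; it rests on
  \<open>(1 - b * a)\<^sup>2 - (a - b)\<^sup>2 = (1 - a\<^sup>2) * (1 - b\<^sup>2)\<close>.\<close>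

lemma pseudo_hyp_dist_of_real:
  fixes a b :: real
  assumes "\<bar>a\<bar> < 1" "\<bar>b\<bar> < 1"
  shows "1 - (pseudo_hyp_dist (of_real a) (of_real b))\<^sup>2 = (1 - a\<^sup>2) * (1 - b\<^sup>2) / (1 - b * a)\<^sup>2"
proof -
  have "\<bar>b * a\<bar> < 1"
    using assms mult_strict_mono'[of "\<bar>b\<bar>" 1 "\<bar>a\<bar>" 1] by (simp add: abs_mult)
  then have ne: "1 - b * a \<noteq> 0"
    by auto
  have "pseudo_hyp_dist (of_real a) (of_real b) = cmod (of_real ((a - b) / (1 - b * a)))"
    by (simp add: pseudo_hyp_dist_def)
  then have "(pseudo_hyp_dist (of_real a) (of_real b))\<^sup>2 = ((a - b) / (1 - b * a))\<^sup>2"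
    by (simp only: norm_of_real power2_abs)
  with ne show ?thesis
    by (simp add: power_divide field_simps) (simp add: power2_eq_square algebra_simps)
qed

lemma carleson_seq_has_prod:
  assumes "carleson_seq z"
  obtains p where "p \<noteq> 0" "(\<lambda>j. if j = k then 1 else pseudo_hyp_dist (z k) (z j)) has_prod p"
  using assms unfolding carleson_seq_def by (metis less_irrefl order.strict_trans2)

text \<open>A repeated point produces a zero factor, hence a zero product. Injectivity is what gives
  each atom of \<open>nu\<close> the mass of a single index.\<close>

lemma carleson_seq_inj:
  assumes "carleson_seq z"
  shows "inj z"
proof (rule injI, rule ccontr)
  fix j k assume eq: "z k = z j" and "k \<noteq> j"
  obtain p where p: "p \<noteq> 0" "(\<lambda>j. if j = k then 1 else pseudo_hyp_dist (z k) (z j)) has_prod p"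
    using carleson_seq_has_prod[OF assms] .
  have "p = 0"
    by (rule has_prod_zeroI[OF p(2), of j]) (use eq \<open>k \<noteq> j\<close> in \<open>simp add: pseudo_hyp_dist_def\<close>)
  with p show False by simp
qed

text \<open>The factors of a convergent product tend to 1, so
  \<open>(1 - \<mu>\<^sub>0\<^sup>2) (1 - \<mu>\<^sub>j\<^sup>2) \<le> 1 - \<rho>(\<mu>\<^sub>0, \<mu>\<^sub>j)\<^sup>2 \<longlongrightarrow> 0\<close>.\<close>

lemma carleson_seq_of_real_tendsto_1:
  fixes \<mu> :: "nat \<Rightarrow> real"
  assumes pos: "\<And>k. 0 < \<mu> k" and "carleson_seq (\<lambda>k. complex_of_real (\<mu> k))"
  shows "\<mu> \<longlonglongrightarrow> 1"
proof -
  have lt1: "\<mu> k < 1" for k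
    using assms(2) unfolding carleson_seq_def by (simp add: abs_less_iff)
  define f where "f = (\<lambda>j. if j = 0 then 1
    else pseudo_hyp_dist (complex_of_real (\<mu> 0)) (complex_of_real (\<mu> j)))"
  obtain p where "p \<noteq> 0" "f has_prod p"
    using carleson_seq_has_prod[OF assms(2), of 0] unfolding f_def by blast
  then have "f \<longlonglongrightarrow> 1"
    by (intro convergent_prod_imp_LIMSEQ) (auto simp: has_prod_iff)
  then have "(\<lambda>j. (1 - (f j)\<^sup>2) / (1 - (\<mu> 0)\<^sup>2)) \<longlonglongrightarrow> (1 - 1\<^sup>2) / (1 - (\<mu> 0)\<^sup>2)"
    using pos[of 0] lt1[of 0] by (intro tendsto_intros) (auto simp: power2_eq_1_iff)
  then have lim: "(\<lambda>j. (1 - (f j)\<^sup>2) / (1 - (\<mu> 0)\<^sup>2)) \<longlonglongrightarrow> 0"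
    by simp
  \<comment> \<open>Index 0 is excluded because \<open>f 0\<close> is the placeholder 1, not a
    distance.\<close>
  have bound: "1 - \<mu> j \<le> (1 - (f j)\<^sup>2) / (1 - (\<mu> 0)\<^sup>2)" if "j > 0" for j
  proof -
    have m: "0 < \<mu> 0" "\<mu> 0 < 1" "0 < \<mu> j" "\<mu> j < 1"
      using pos lt1 by auto
    then have sq: "(\<mu> 0)\<^sup>2 < 1" "(\<mu> j)\<^sup>2 \<le> \<mu> j"
      using mult_left_le_one_le[of "\<mu> j" "\<mu> j"]
      by (auto simp: power_less_one_iff) (simp add: power2_eq_square)
    have prod: "0 < \<mu> j * \<mu> 0" "\<mu> j * \<mu> 0 < 1"
      using m mult_strict_mono[of "\<mu> j" 1 "\<mu> 0" 1] by auto
    have d: "0 < (1 - \<mu> j * \<mu> 0)\<^sup>2" "(1 - \<mu> j * \<mu> 0)\<^sup>2 \<le> 1"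
      using prod by (auto intro: power_le_one)
    have "1 - (f j)\<^sup>2 = (1 - (\<mu> 0)\<^sup>2) * (1 - (\<mu> j)\<^sup>2) / (1 - \<mu> j * \<mu> 0)\<^sup>2"
      using that m unfolding f_def by (simp add: pseudo_hyp_dist_of_real)
    then have "(1 - (f j)\<^sup>2) / (1 - (\<mu> 0)\<^sup>2) = (1 - (\<mu> j)\<^sup>2) / (1 - \<mu> j * \<mu> 0)\<^sup>2"
      using sq by simp
    also have "\<dots> \<ge> (1 - (\<mu> j)\<^sup>2) / 1"
      using d sq m by (intro divide_left_mono) auto
    finally show ?thesis
      using sq by simp
  qed
  have "(\<lambda>j. 1 - \<mu> j) \<longlonglongrightarrow> 0"
  proof (rule tendsto_sandwich[OF _ _ tendsto_const lim])
    show "eventually (\<lambda>j. 0 \<le> 1 - \<mu> j) sequentially"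
      using lt1 by (simp add: less_imp_le)
    show "eventually (\<lambda>j. 1 - \<mu> j \<le> (1 - (f j)\<^sup>2) / (1 - (\<mu> 0)\<^sup>2)) sequentially"
      using eventually_gt_at_top[of 0] by eventually_elim (rule bound)
  qed
  from tendsto_diff[OF tendsto_const[of 1] this] show ?thesis
    by simp
qed

section \<open>The infimum over the atoms and the failure of the lower frame bound\<close>

lemma INF_mult_infsum_power_eq_0:
  fixes \<mu> :: "nat \<Rightarrow> real"
  assumes \<mu>: "\<And>k. 0 < \<mu> k" "\<And>k. \<mu> k < 1" "\<mu> \<longlonglongrightarrow> 1"
    and lim: "((\<lambda>x::real. ennreal x * (\<Sum>\<^sub>\<infinity>n\<in>A. ennreal (exp (- real (lam n) * x))))
          \<longlongrightarrow> 0) (at_right 0)"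
  shows "(INF k. ennreal (1 - (\<mu> k)\<^sup>2) * (\<Sum>\<^sub>\<infinity>n\<in>A. ennreal (\<mu> k ^ (2 * lam n)))) = 0"
proof -
  define x where "x k = - ln ((\<mu> k)\<^sup>2)" for k
  define g where "g x = ennreal x * (\<Sum>\<^sub>\<infinity>n\<in>A. ennreal (exp (- real (lam n) * x)))" for x
  have x_pos: "0 < x k" for k
    using \<mu>(1,2)[of k] by (simp add: x_def power_less_one_iff)
  have "x \<longlonglongrightarrow> - ln (1\<^sup>2)"
    unfolding x_def by (intro tendsto_intros \<mu>(3)) auto
  \<comment> \<open>Positivity of every \<open>x k\<close> upgrades convergence to 0 to convergence
    from the right, where (b) applies.\<close>
  then have "filterlim x (at_right 0) sequentially"
    using x_pos by (intro tendsto_imp_filterlim_at_right) auto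
  then have "(\<lambda>k. g (x k)) \<longlonglongrightarrow> 0"
    using lim unfolding g_def by (rule filterlim_compose[rotated])
  moreover have "(INF k. ennreal (1 - (\<mu> k)\<^sup>2) * (\<Sum>\<^sub>\<infinity>n\<in>A. ennreal (\<mu> k ^ (2 * lam n)))) \<le> g (x j)" for j
  proof (rule INF_lower2)
    have sq: "0 < (\<mu> j)\<^sup>2"
      using \<mu>(1)[of j] by simp
    have "exp (- real (lam n) * x j) = \<mu> j ^ (2 * lam n)" for n
      using sq by (simp add: x_def exp_of_nat_mult power_mult)
    moreover have "1 - (\<mu> j)\<^sup>2 \<le> x j"
      using ln_le_minus_one[OF sq] by (simp add: x_def)
    ultimately show "ennreal (1 - (\<mu> j)\<^sup>2) * (\<Sum>\<^sub>\<infinity>n\<in>A. ennreal (\<mu> j ^ (2 * lam n))) \<le> g (x j)"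
      unfolding g_def by (auto intro!: mult_right_mono ennreal_leI)
  qed simp
  ultimately have "(INF k. ennreal (1 - (\<mu> k)\<^sup>2) * (\<Sum>\<^sub>\<infinity>n\<in>A. ennreal (\<mu> k ^ (2 * lam n)))) \<le> 0"
    by (intro LIMSEQ_le_const) auto
  then show ?thesis
    by simp
qed

text \<open>Tests the lower bound on the indicator function of the atom \<open>\<mu>\<^sub>k\<close>.\<close>

lemma lower_bound_le_atom:
  fixes \<mu> :: "nat \<Rightarrow> real"
  assumes \<mu>: "\<And>k. 0 < \<mu> k" "\<And>k. \<mu> k < 1" "inj \<mu>"
    and A: "A > 0" "\<forall>f\<in>L2 (nu \<mu>). ennreal (A * (L2_norm (nu \<mu>) f)\<^sup>2)
            \<le> (\<Sum>\<^sub>\<infinity>n\<in>I. ennreal ((cmod (L2_inner (nu \<mu>) f (power_fun (lam n))))\<^sup>2))"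
  shows "ennreal A \<le> ennreal (1 - (\<mu> k)\<^sup>2) * (\<Sum>\<^sub>\<infinity>n\<in>I. ennreal (\<mu> k ^ (2 * lam n)))"
proof -
  define w where "w = 1 - (\<mu> k)\<^sup>2"
  define a where "a = \<mu> k"
  define f :: "real \<Rightarrow> complex" where "f = indicator {a}"
  have a: "0 < a" "a < 1" and w: "0 < w"
    using \<mu>(1,2)[of k] by (simp_all add: a_def w_def power_less_one_iff)
  have sets: "{a} \<in> sets (nu \<mu>)"
    using a by (simp add: sets_restrict_space_iff)
  have "emeasure (nu \<mu>) {a} = (\<Sum>j. ennreal (1 - (\<mu> j)\<^sup>2) * indicator {a} (\<mu> j))"
    using sets by (intro emeasure_nu) simp
  \<comment> \<open>As \<open>\<mu>\<close> is injective, only the index \<open>k\<close> hits the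
    atom \<open>a\<close>.\<close>
  also have "\<dots> = (\<Sum>j\<in>{k}. ennreal (1 - (\<mu> j)\<^sup>2) * indicator {a} (\<mu> j))"
    using \<mu>(3) by (intro suminf_finite) (auto simp: a_def inj_eq)
  finally have em: "emeasure (nu \<mu>) {a} = ennreal w"
    by (simp add: a_def w_def)
  then have meas: "measure (nu \<mu>) {a} = w"
    using w by (simp add: measure_def)
  have fin: "emeasure (nu \<mu>) {a} < \<infinity>"
    by (simp add: em)
  have norm: "has_bochner_integral (nu \<mu>) (\<lambda>t. (cmod (f t))\<^sup>2) w"
    using has_bochner_integral_indicator[OF sets fin, of "1::real"]
    by (rule has_bochner_integral_cong[THEN iffD1, rotated -1])
      (auto simp: f_def meas split: split_indicator)
  have inner: "L2_inner (nu \<mu>) f (power_fun m) = of_real (w * a ^ m)" for m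
  proof -
    have "has_bochner_integral (nu \<mu>) (\<lambda>t. f t * cnj (power_fun m t)) (of_real (w * a ^ m))"
      using has_bochner_integral_indicator[OF sets fin, of "of_real (a ^ m) :: complex"]
      by (rule has_bochner_integral_cong[THEN iffD1, rotated -1])
        (auto simp: f_def power_fun_def meas scaleR_conv_of_real split: split_indicator)
    then show ?thesis
      unfolding L2_inner_def by (rule has_bochner_integral_integral_eq)
  qed
  have "f \<in> L2 (nu \<mu>)"
    unfolding L2_def using sets norm by (auto simp: f_def has_bochner_integral_iff)
  moreover have "(L2_norm (nu \<mu>) f)\<^sup>2 = w"
    using norm w by (simp add: L2_norm_def has_bochner_integral_iff)
  ultimately have "ennreal (A * w) \<le> (\<Sum>\<^sub>\<infinity>n\<in>I. ennreal ((cmod (L2_inner (nu \<mu>) f (power_fun (lam n))))\<^sup>2))"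
    using A(2) by metis
  \<comment> \<open>The squared norm contributes one factor \<open>w\<close>, each squared
    coefficient contributes \<open>w\<^sup>2\<close>. Cancelling one positive finite
    \<open>w\<close> leaves the product in (c).\<close>
  also have "\<dots> = (\<Sum>\<^sub>\<infinity>n\<in>I. ennreal (w\<^sup>2) * ennreal (a ^ (2 * lam n)))"
    by (simp only: inner norm_of_real power2_abs power_mult_distrib power_even_eq
        ennreal_mult' zero_le_power2)
  also have "\<dots> = ennreal (w\<^sup>2) * (\<Sum>\<^sub>\<infinity>n\<in>I. ennreal (a ^ (2 * lam n)))"
    by (rule infsum_cmult_ennreal)
  also have "ennreal (w\<^sup>2) = ennreal w * ennreal w"
    using w by (simp add: power2_eq_square ennreal_mult')
  finally have "ennreal w * ennreal A
      \<le> ennreal w * (ennreal w * (\<Sum>\<^sub>\<infinity>n\<in>I. ennreal (a ^ (2 * lam n))))"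
    using w A(1) by (simp add: ennreal_mult' mult_ac)
  then show ?thesis
    using w unfolding w_def a_def
    by (subst (asm) ennreal_mult_le_mult_iff) auto
qed

theorem mainTheorem1:
  fixes \<mu> :: "nat \<Rightarrow> real" and lam :: "nat \<Rightarrow> nat"
  assumes "\<And>k. 0 < \<mu> k \<and> \<mu> k < 1"
    and "carleson_seq (\<lambda>k. complex_of_real (\<mu> k))"
    and "(\<forall>n\<ge>2. lam n = nat \<lceil>real n * ln (real n)\<rceil>) \<or> (\<forall>n\<ge>2. lam n = nth_prime n)"
  shows "(\<Sum>\<^sub>\<infinity>n\<in>{2..}. ennreal (1 / real (lam n))) = \<infinity>
    \<and> ((\<lambda>x::real. ennreal x * (\<Sum>\<^sub>\<infinity>n\<in>{2..}. ennreal (exp (- real (lam n) * x))))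
          \<longlongrightarrow> 0) (at_right 0)
    \<and> (INF k. ennreal (1 - (\<mu> k)\<^sup>2) * (\<Sum>\<^sub>\<infinity>n\<in>{2..}. ennreal (\<mu> k ^ (2 * lam n)))) = 0
    \<and> \<not> (\<exists>A>0. \<forall>f\<in>L2 (nu \<mu>). ennreal (A * (L2_norm (nu \<mu>) f)\<^sup>2)
            \<le> (\<Sum>\<^sub>\<infinity>n\<in>{2..}. ennreal ((cmod (L2_inner (nu \<mu>) f (power_fun (lam n))))\<^sup>2)))
    \<and> \<not> L2_frame (nu \<mu>) {2..} (\<lambda>n. power_fun (lam n))"
proof -
  have \<mu>: "0 < \<mu> k" "\<mu> k < 1" for k
    using assms(1) by auto
  have lim1: "\<mu> \<longlonglongrightarrow> 1"
    using \<mu>(1) assms(2) by (rule carleson_seq_of_real_tendsto_1)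
  have inj: "inj \<mu>"
    using carleson_seq_inj[OF assms(2)] by (simp add: inj_def)
  \<comment> \<open>\<open>lam\<close> is prescribed only from index 2 on, which a limit at infinity
    does not notice.\<close>
  from assms(3) have superlinear: "filterlim (\<lambda>n. real (lam n) / real n) at_top sequentially"
  proof
    assume "\<forall>n\<ge>2. lam n = nat \<lceil>real n * ln (real n)\<rceil>"
    then show ?thesis
      by (intro filterlim_cong[THEN iffD1, OF refl refl _ ceiling_n_ln_n_superlinear]
          eventually_sequentiallyI[of 2]) simp
  next
    assume "\<forall>n\<ge>2. lam n = nth_prime n"
    then show ?thesis
      by (intro filterlim_cong[THEN iffD1, OF refl refl _ nth_prime_superlinear]
          eventually_sequentiallyI[of 2]) simp
  qed
  have a: "(\<Sum>\<^sub>\<infinity>n\<in>{2..}. ennreal (1 / real (lam n))) = \<infinity>"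
    using assms(3)
  proof
    assume "\<forall>n\<ge>2. lam n = nat \<lceil>real n * ln (real n)\<rceil>"
    then show ?thesis
      by (subst infsum_inverse_ceiling_n_ln_n[symmetric]) (rule infsum_cong, simp)
  next
    assume "\<forall>n\<ge>2. lam n = nth_prime n"
    then show ?thesis
      by (subst infsum_inverse_nth_prime[symmetric]) (rule infsum_cong, simp)
  qed
  have b: "((\<lambda>x::real. ennreal x * (\<Sum>\<^sub>\<infinity>n\<in>{2..}. ennreal (exp (- real (lam n) * x))))
      \<longlongrightarrow> 0) (at_right 0)"
    by (rule tendsto_mult_infsum_exp[OF superlinear])
  have c: "(INF k. ennreal (1 - (\<mu> k)\<^sup>2)
      * (\<Sum>\<^sub>\<infinity>n\<in>{2..}. ennreal (\<mu> k ^ (2 * lam n)))) = 0"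
    by (rule INF_mult_infsum_power_eq_0[OF \<mu> lim1 b])
  have d: "\<not> (\<exists>A>0. \<forall>f\<in>L2 (nu \<mu>). ennreal (A * (L2_norm (nu \<mu>) f)\<^sup>2)
      \<le> (\<Sum>\<^sub>\<infinity>n\<in>{2..}. ennreal ((cmod (L2_inner (nu \<mu>) f (power_fun (lam n))))\<^sup>2)))"
  proof
    assume "\<exists>A>0. \<forall>f\<in>L2 (nu \<mu>). ennreal (A * (L2_norm (nu \<mu>) f)\<^sup>2)
      \<le> (\<Sum>\<^sub>\<infinity>n\<in>{2..}. ennreal ((cmod (L2_inner (nu \<mu>) f (power_fun (lam n))))\<^sup>2))"
    then obtain A where A: "A > 0" "\<forall>f\<in>L2 (nu \<mu>). ennreal (A * (L2_norm (nu \<mu>) f)\<^sup>2)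
      \<le> (\<Sum>\<^sub>\<infinity>n\<in>{2..}. ennreal ((cmod (L2_inner (nu \<mu>) f (power_fun (lam n))))\<^sup>2))"
      by blast
    \<comment> \<open>The atoms make \<open>A\<close> a lower bound for all the products in (c),
      whose infimum is 0.\<close>
    have "ennreal A \<le> (INF k. ennreal (1 - (\<mu> k)\<^sup>2)
      * (\<Sum>\<^sub>\<infinity>n\<in>{2..}. ennreal (\<mu> k ^ (2 * lam n))))"
      by (intro INF_greatest lower_bound_le_atom[OF \<mu> inj A])
    with c A(1) show False
      by simp
  qed
  then have "\<not> L2_frame (nu \<mu>) {2..} (\<lambda>n. power_fun (lam n))"
    unfolding L2_frame_def L2_lower_bound_def by blast
  with a b c d show ?thesis
    by blast
qed

end
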